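(* Let $m\in\mathbb{N}$ be even, $n\in\mathbb{N}$ and $\alpha,\lambda\in\mathbb{C}$. Then $$G_{n}^{(\alpha)}(mx;\lambda)=(-2)^{\alpha}m^{n-\alpha}\sum_{v_{1},v_{2},\dots,v_{m-1}\geq 0}\binom{\alpha}{v_{1},v_{2},\dots,v_{m-1}}(-\lambda)^{r}\,B_{n}^{(\alpha)}\Big(x+\frac{r}{m};\lambda^{m}\Big),$$ where $r=v_{1}+2v_{2}+\dots+(m-1)v_{m-1}$ and the sum runs over all tuples of nonnegative integers $(v_1,\dots,v_{m-1})$.
   Context: Apostol-Genocchi polynomials of order $\alpha$: $\Big(\frac{2z}{\lambda e^{z}+1}\Big)^{\alpha}e^{xz}=\sum_{n\ge0}G_{n}^{(\alpha)}(x;\lambda)\frac{z^{n}}{n!}$. Apostol-Bernoulli polynomials of order $\alpha$: $\Big(\frac{z}{\lambda e^{z}-1}\Big)^{\alpha}e^{xz}=\sum_{n\ge0}B_{n}^{(\alpha)}(x;\lambda)\frac{z^{n}}{n!}$. For complex $\alpha$ and nonnegative integers $v_i$, $\binom{\alpha}{v_1,\dots,v_{m-1}}=\frac{\alpha(\alpha-1)\cdots(\alpha-(v_1+\dots+v_{m-1})+1)}{v_1!\cdots v_{m-1}!}$, the coefficient of $y_1^{v_1}\cdots y_{m-1}^{v_{m-1}}$ in $(1+y_1+\dots+y_{m-1})^{\alpha}$.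
   Formalization: Assumes α is a nonnegative integer or λ = −1, since otherwise the generating function is no power series and G_n^{(α)} is undefined; for α not a nonnegative integer the formula is asserted only when the sum converges (unconditionally, or via partial sums over r ≤ N), as it can diverge. *)

theory Defs
  imports "HOL-Analysis.Analysis" "HOL-Computational_Algebra.Formal_Power_Series"
begin

(* Complex powers of formal power series.  For a natural exponent this is the ordinary power.
   Otherwise f^\<alpha> = f(0)^\<alpha> * (1 + (f/f(0) - 1))^\<alpha>, by the binomial series and with the principal
   value of f(0)^\<alpha> (so 1^\<alpha> = 1); this needs f(0) to be nonzero.  A series f = z * u with u(0)
   nonzero has f^\<alpha> = z^\<alpha> * u^\<alpha>, which is a power series in z only for natural \<alpha>. *)

definition fps_has_cpow :: "complex fps \<Rightarrow> complex \<Rightarrow> bool" where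
  "fps_has_cpow f \<alpha> \<longleftrightarrow> \<alpha> \<in> \<nat> \<or> fps_nth f 0 \<noteq> 0"

definition fps_cpow :: "complex fps \<Rightarrow> complex \<Rightarrow> complex fps" where
  "fps_cpow f \<alpha> =
     (if \<alpha> \<in> \<nat> then f ^ (THE k. \<alpha> = of_nat k)
      else fps_const (fps_nth f 0 powr \<alpha>) *
           (fps_binomial \<alpha> oo (fps_const (inverse (fps_nth f 0)) * f - 1)))"

lemma fps_cpow_of_nat [simp]: "fps_cpow f (of_nat k) = f ^ k"
  by (simp add: fps_cpow_def)

(* The two clauses of the definition agree where both make sense. *)
lemma fps_cpow_unit:
  assumes "fps_nth f 0 \<noteq> 0"
  shows "fps_cpow f \<alpha> = fps_const (fps_nth f 0 powr \<alpha>) *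
           (fps_binomial \<alpha> oo (fps_const (inverse (fps_nth f 0)) * f - 1))"
proof (cases "\<alpha> \<in> \<nat>")
  case True
  then obtain k where k: "\<alpha> = of_nat k" by (auto elim: Nats_cases)
  define c where "c = fps_nth f 0"
  define g where "g = fps_const (inverse c) * f - 1"
  have c: "c \<noteq> 0" and g0: "fps_nth g 0 = 0"
    using assms by (auto simp: c_def g_def)
  have "fps_binomial \<alpha> oo g = (1 + fps_X) ^ k oo g"
    by (simp add: k fps_binomial_of_nat)
  also have "\<dots> = ((1 + fps_X) oo g) ^ k"
    using g0 by (simp add: fps_compose_power)
  also have "(1 + fps_X) oo g = 1 + g"
    using g0 by (simp add: fps_compose_add_distrib)
  also have "\<dots> = fps_const (inverse c) * f"
    by (simp add: g_def)
  finally have "fps_const (c powr \<alpha>) * (fps_binomial \<alpha> oo g) = fps_const (c ^ k * inverse c ^ k) * f ^ k"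
    using c by (simp add: k powr_nat' power_mult_distrib fps_const_power
                     mult.assoc [symmetric] del: fps_const_mult)
  also have "c ^ k * inverse c ^ k = 1"
    using c by (simp add: power_mult_distrib [symmetric])
  finally show ?thesis
    by (simp add: k c_def g_def)
qed (simp add: fps_cpow_def)

(* 2z/(lam e^z + 1) and z/(lam e^z - 1).  Both are genuine power series for every lam: where the
   denominator vanishes at 0 it does so to first order, and fps division cancels the factor z. *)

definition genocchi_base :: "complex \<Rightarrow> complex fps" where
  "genocchi_base lam = (2 * fps_X) / (fps_const lam * fps_exp 1 + 1)"

definition bernoulli_base :: "complex \<Rightarrow> complex fps" where
  "bernoulli_base lam = fps_X / (fps_const lam * fps_exp 1 - 1)"

definition apostol_genocchi :: "nat \<Rightarrow> complex \<Rightarrow> complex \<Rightarrow> complex \<Rightarrow> complex" where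
  "apostol_genocchi n \<alpha> x lam = fact n * fps_nth (fps_cpow (genocchi_base lam) \<alpha> * fps_exp x) n"

definition apostol_bernoulli :: "nat \<Rightarrow> complex \<Rightarrow> complex \<Rightarrow> complex \<Rightarrow> complex" where
  "apostol_bernoulli n \<alpha> x lam = fact n * fps_nth (fps_cpow (bernoulli_base lam) \<alpha> * fps_exp x) n"

lemma subdegree_apostol_denom_le_1:
  assumes "c \<noteq> (0 :: complex)"
  shows "fps_const lam * fps_exp 1 + fps_const c \<noteq> 0"
    and "subdegree (fps_const lam * fps_exp 1 + fps_const c) \<le> 1"
proof -
  let ?f = "fps_const lam * fps_exp 1 + fps_const c"
  have "fps_nth ?f 0 = lam + c" "fps_nth ?f 1 = lam"
    by simp_all
  then have *: "fps_nth ?f 0 \<noteq> 0 \<or> fps_nth ?f 1 \<noteq> 0"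
    using assms by auto
  then show "?f \<noteq> 0"
    by (metis fps_zero_nth)
  show "subdegree ?f \<le> 1"
    using * subdegree_leI [of ?f 0] subdegree_leI [of ?f 1] by linarith
qed

lemma genocchi_base_times: "genocchi_base lam * (fps_const lam * fps_exp 1 + 1) = 2 * fps_X"
proof -
  have "subdegree (2 * fps_X :: complex fps) = 1"
    by (simp add: fps_numeral_fps_const)
  then show ?thesis
    using subdegree_apostol_denom_le_1 [of 1 lam]
    unfolding genocchi_base_def by (simp add: fps_divide_times_eq fps_dvd_iff)
qed

lemma bernoulli_base_times: "bernoulli_base lam * (fps_const lam * fps_exp 1 - 1) = fps_X"
proof -
  have eq: "fps_const lam * fps_exp 1 + fps_const (- 1) = fps_const lam * fps_exp 1 - (1 :: complex fps)"
    by (simp add: fps_eq_iff)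
  show ?thesis
    using subdegree_apostol_denom_le_1 [of "- 1" lam]
    unfolding bernoulli_base_def eq by (simp add: fps_dvd_iff)
qed

lemma fps_has_cpow_genocchi_base_iff: "fps_has_cpow (genocchi_base lam) \<alpha> \<longleftrightarrow> \<alpha> \<in> \<nat> \<or> lam = - 1"
proof -
  let ?g = "genocchi_base lam"
  have 0: "fps_nth ?g 0 * (lam + 1) = 0"
    using arg_cong [OF genocchi_base_times [of lam], of "\<lambda>f. fps_nth f 0"] by simp
  have 1: "fps_nth ?g 0 * lam + fps_nth ?g 1 * (lam + 1) = 2"
    using arg_cong [OF genocchi_base_times [of lam], of "\<lambda>f. fps_nth f 1"]
    by (simp add: fps_mult_nth fps_numeral_fps_const)
  have "fps_nth ?g 0 \<noteq> 0 \<longleftrightarrow> lam = - 1"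
    using 0 1 by (auto simp: eq_neg_iff_add_eq_0)
  then show ?thesis
    by (simp add: fps_has_cpow_def)
qed

lemma fps_has_cpow_bernoulli_base_iff: "fps_has_cpow (bernoulli_base lam) \<alpha> \<longleftrightarrow> \<alpha> \<in> \<nat> \<or> lam = 1"
proof -
  let ?g = "bernoulli_base lam"
  have 0: "fps_nth ?g 0 * (lam - 1) = 0"
    using arg_cong [OF bernoulli_base_times [of lam], of "\<lambda>f. fps_nth f 0"] by simp
  have 1: "fps_nth ?g 0 * lam + fps_nth ?g 1 * (lam - 1) = 1"
    using arg_cong [OF bernoulli_base_times [of lam], of "\<lambda>f. fps_nth f 1"]
    by (simp add: fps_mult_nth)
  have "fps_nth ?g 0 \<noteq> 0 \<longleftrightarrow> lam = 1"
    using 0 1 by auto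
  then show ?thesis
    by (simp add: fps_has_cpow_def)
qed

(* For even m, whenever G_n^(\<alpha>)(.; lam) is defined, so is B_n^(\<alpha>)(.; lam^m). *)
lemma fps_has_cpow_bernoulli_base_power:
  "even m \<Longrightarrow> fps_has_cpow (genocchi_base lam) \<alpha> \<Longrightarrow> fps_has_cpow (bernoulli_base (lam ^ m)) \<alpha>"
  by (auto simp: fps_has_cpow_genocchi_base_iff fps_has_cpow_bernoulli_base_iff)

(* Tuples (v_1, ..., v_{m-1}) are functions on {1..m-1}, extended by undefined outside.
   weight is the exponent r = v_1 + 2 v_2 + ... + (m-1) v_{m-1}; the sets of tuples with r \<le> N are
   finite and exhaust all tuples.  A multiple series over tuples can be read as an unconditional
   sum or as the limit of its partial sums over r \<le> N, which exists in more cases. *)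

definition tuples :: "nat \<Rightarrow> (nat \<Rightarrow> nat) set" where
  "tuples m = {1..m - 1} \<rightarrow>\<^sub>E UNIV"

definition weight :: "nat \<Rightarrow> (nat \<Rightarrow> nat) \<Rightarrow> nat" where
  "weight m v = (\<Sum>i = 1..m - 1. i * v i)"

definition multinom :: "nat \<Rightarrow> complex \<Rightarrow> (nat \<Rightarrow> nat) \<Rightarrow> complex" where
  "multinom m \<alpha> v = (\<Prod>j < (\<Sum>i = 1..m - 1. v i). \<alpha> - of_nat j) / (\<Prod>i = 1..m - 1. fact (v i))"

end

(* Since m is even, (1 + lam e^z) * (sum over j < m of (- lam e^z)^j) = 1 - lam^m e^(mz), so the
   Genocchi generating function is -2/m times the Bernoulli one at mz with parameter lam^m, times
   that sum.  Raise this to the power alpha and expand the sum by the multinomial theorem.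
   For alpha in Nat the expansion is finite and everything is formal.  Otherwise lam = -1, and the
   terms of weight r add up to a(r) Q(r), where Q is a polynomial and the a(r) are the coefficients
   of A(t) = (1 + t + ... + t^(m-1))^alpha.  If the partial sums converge, their limit is the limit
   of the sum of a(r) Q(r) t^r = Q(t d/dt) A(t) for t -> 1-, by Abel's theorem.  Substituting
   t = e^s turns t d/dt into d/ds, and A(e^s) is analytic at s = 0, so this limit is read off from
   the Taylor coefficients of A(e^s) at 0, i.e. from the formal power series identity. *)
theory Submission
  imports Defs "HOL-Complex_Analysis.Laurent_Convergence"
begin

section \<open>Abel's limit theorem\<close>

text \<open>Summation by parts: with \<open>d n\<close> the error of the n-th partial sum and D(t)
  the sum of d(n) t^n, one has b(n) = d(n+1) - d(n), so the series equals L/t + (1 - t) D(t)/t. As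
  \<open>d\<close> tends to 0, so does (1 - t) D(t).\<close>

lemma Abel_limit:
  fixes b :: "nat \<Rightarrow> complex"
  assumes b: "b sums L"
  shows "((\<lambda>t. \<Sum>n. b n * of_real t ^ n) \<longlongrightarrow> L) (at_left (1::real))"
proof -
  define d where "d n = (\<Sum>i<n. b i) - L" for n
  have d0: "d \<longlonglongrightarrow> 0"
    using b unfolding sums_def d_def by (rule LIM_zero)
  then obtain C where C: "\<And>n. norm (d n) \<le> C"
    using convergent_imp_Bseq[of d] by (auto simp: convergent_def Bseq_def)
  have nd: "summable (\<lambda>n. norm (d n * of_real t ^ n))" if "0 < t" "t < 1" for t :: real
  proof (rule summable_comparison_test')
    show "summable (\<lambda>n. C * t ^ n)"
      using that by (intro summable_mult summable_geometric) auto
    show "norm (norm (d n * of_real t ^ n)) \<le> C * t ^ n" if "n \<ge> 0" for n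
      using \<open>0 < t\<close> C[of n] by (simp add: norm_mult norm_power mult_right_mono)
  qed
  define D where "D t = (\<Sum>n. d n * of_real t ^ n)" for t :: real
  have eq: "(\<Sum>n. b n * of_real t ^ n) = L / of_real t + of_real (1 - t) * D t / of_real t"
    if t: "0 < t" "t < 1" for t :: real
  proof -
    have s: "(\<lambda>n. d n * of_real t ^ n) sums D t"
      using summable_norm_cancel[OF nd[OF t]] by (simp add: D_def summable_sums)
    have "(\<lambda>n. d (Suc n) * of_real t ^ Suc n) sums (D t + L)"
      \<comment> \<open>The sum over i < 0 is empty, so d(0) = -L; dropping the term of index 0
        therefore adds L.\<close>
      using sums_Suc_iff[of "\<lambda>n. d n * of_real t ^ n" "D t + L"] s by (simp add: d_def)
    then have "(\<lambda>n. d (Suc n) * of_real t ^ Suc n / of_real t) sums ((D t + L) / of_real t)"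
      by (rule sums_divide)
    from sums_diff[OF this s] have "(\<lambda>n. b n * of_real t ^ n) sums ((D t + L) / of_real t - D t)"
      using t by (simp add: d_def algebra_simps diff_divide_distrib add_divide_distrib)
    then show ?thesis
      using t by (simp add: sums_iff field_simps)
  qed
  have "((\<lambda>t. of_real (1 - t) * D t) \<longlongrightarrow> 0) (at_left 1)"
  proof (rule tendstoI)
    fix e :: real assume e: "e > 0"
    from d0 e obtain N where N: "\<And>n. n \<ge> N \<Longrightarrow> norm (d n) < e / 2"
      using LIMSEQ_D[of d 0 "e/2"] by auto
    define M where "M = (\<Sum>n<N. norm (d n))"
    \<comment> \<open>The first N terms of D(t) are bounded by \<open>M\<close>, independently of t.
      The tail is dominated by a geometric series of sum (e/2)/(1 - t), and the factor 1 - t turns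
      this into e/2.\<close>
    have bound: "norm (of_real (1 - t) * D t) \<le> (1 - t) * M + e / 2" if t: "0 < t" "t < 1" for t
    proof -
      have "norm (D t) \<le> (\<Sum>n. norm (d n * of_real t ^ n))"
        unfolding D_def by (rule summable_norm[OF nd[OF t]])
      also have "\<dots> = (\<Sum>n. norm (d (n + N) * of_real t ^ (n + N))) + (\<Sum>n<N. norm (d n * of_real t ^ n))"
        by (rule suminf_split_initial_segment[OF nd[OF t]])
      also have "\<dots> \<le> (\<Sum>n. e / 2 * t ^ n) + M"
      proof (rule add_mono)
        show "(\<Sum>n. norm (d (n + N) * of_real t ^ (n + N))) \<le> (\<Sum>n. e / 2 * t ^ n)"
        proof (rule suminf_le)
          show "norm (d (n + N) * of_real t ^ (n + N)) \<le> e / 2 * t ^ n" for n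
            using t N[of "n + N"] power_decreasing[of n "n + N" t] mult_mono[of "norm (d (n + N))" "e / 2" "t ^ (n + N)" "t ^ n"] e
            by (simp add: norm_mult norm_power)
          show "summable (\<lambda>n. norm (d (n + N) * complex_of_real t ^ (n + N)))"
            by (subst summable_iff_shift[of "\<lambda>n. norm (d n * complex_of_real t ^ n)"]) (rule nd[OF t])
          show "summable (\<lambda>n. e / 2 * t ^ n)"
            using t by (intro summable_mult summable_geometric) auto
        qed
        show "(\<Sum>n<N. norm (d n * of_real t ^ n)) \<le> M"
          unfolding M_def using t
          by (intro sum_mono) (auto simp: norm_mult norm_power intro!: mult_left_le power_le_one)
      qed
      also have "(\<Sum>n. e / 2 * t ^ n) = e / 2 / (1 - t)"
        using t by (subst suminf_mult) (auto simp: suminf_geometric summable_geometric)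
      finally have "(1 - t) * norm (D t) \<le> (1 - t) * (e / 2 / (1 - t) + M)"
        using t by (intro mult_left_mono) auto
      also have "\<dots> = (1 - t) * M + e / 2"
        using t nonzero_mult_div_cancel_left[of "1 - t" "e / 2"] by (simp only: distrib_left) simp
      finally show ?thesis
        using t by (simp add: norm_mult del: of_real_diff)
    qed
    have "((\<lambda>t. (1 - t) * M + e / 2) \<longlongrightarrow> (1 - 1) * M + e / 2) (at_left 1)"
      by (intro tendsto_intros)
    from order_tendstoD(2)[OF this, of e] have "eventually (\<lambda>t. (1 - t) * M + e / 2 < e) (at_left 1)"
      using e by simp
    moreover have "eventually (\<lambda>t. 0 < t \<and> t < 1) (at_left (1::real))"
      using eventually_at_left[of 0 "1::real"] by (auto intro: exI[of _ 0])
    ultimately show "eventually (\<lambda>t. dist (of_real (1 - t) * D t) 0 < e) (at_left 1)"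
      by eventually_elim (use bound in fastforce)
  qed
  then have "((\<lambda>t. L / of_real t + of_real (1 - t) * D t / of_real t) \<longlongrightarrow> L / of_real 1 + 0 / of_real 1) (at_left 1)"
    by (intro tendsto_intros) auto
  moreover have "eventually (\<lambda>t. L / of_real t + of_real (1 - t) * D t / of_real t = (\<Sum>n. b n * of_real t ^ n)) (at_left (1::real))"
    using eq by (intro eventually_at_leftI[of 0]) auto
  ultimately show ?thesis
    using tendsto_cong by force
qed

section \<open>The multinomial theorem\<close>

text \<open>Divided powers y^k/k!: the binomial and multinomial theorems become convolutions without
  coefficients, which suits induction on the number of summands.\<close>

definition divided_pow :: "'a::field_char_0 fps \<Rightarrow> nat \<Rightarrow> 'a fps" where
  "divided_pow y k = fps_const (inverse (fact k)) * y ^ k"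

lemma divided_pow_add: "divided_pow (y + z) k = (\<Sum>a\<le>k. divided_pow y a * divided_pow z (k - a))"
proof -
  have "divided_pow (y + z) k = (\<Sum>a\<le>k. fps_const (inverse (fact k)) * (of_nat (k choose a) * y ^ a * z ^ (k - a)))"
    by (simp add: divided_pow_def binomial_ring sum_distrib_left)
  also have "\<dots> = (\<Sum>a\<le>k. divided_pow y a * divided_pow z (k - a))"
  proof (rule sum.cong[OF refl])
    fix a assume "a \<in> {..k}"
    then have "inverse (fact k) * of_nat (k choose a) = (inverse (fact a) * inverse (fact (k - a)) :: 'a)"
      by (simp add: binomial_fact field_simps)
    then have "fps_const (inverse (fact k)) * of_nat (k choose a) = 
       fps_const (inverse (fact a)) * fps_const (inverse (fact (k - a)) :: 'a)"
      by (simp flip: fps_of_nat)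
    then show "fps_const (inverse (fact k)) * (of_nat (k choose a) * y ^ a * z ^ (k - a)) = divided_pow y a * divided_pow z (k - a)"
      unfolding divided_pow_def by (simp add: mult_ac del: fps_const_mult)
  qed
  finally show ?thesis .
qed

lemma finite_compositions:
  assumes "finite I"
  shows "finite {v \<in> I \<rightarrow>\<^sub>E (UNIV :: nat set). sum v I \<le> k}"
proof (rule finite_subset)
  show "finite (I \<rightarrow>\<^sub>E {..k})"
    using assms by (intro finite_PiE) auto
  show "{v \<in> I \<rightarrow>\<^sub>E UNIV. sum v I \<le> k} \<subseteq> I \<rightarrow>\<^sub>E {..k}"
  proof
    fix v assume v: "v \<in> {v \<in> I \<rightarrow>\<^sub>E (UNIV :: nat set). sum v I \<le> k}"
    then have "v i \<le> k" if "i \<in> I" for i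
      using member_le_sum[OF that, of v] assms by simp
    with v show "v \<in> I \<rightarrow>\<^sub>E {..k}"
      by (simp add: PiE_iff)
  qed
qed

text \<open>Induction on \<open>I\<close>: the two-term rule splits off the exponent a of the new
  index, and the remaining exponents add up to k - a.\<close>

lemma divided_pow_sum:
  assumes "finite I"
  shows "divided_pow (\<Sum>i\<in>I. y i) k = (\<Sum>v | v \<in> I \<rightarrow>\<^sub>E UNIV \<and> sum v I = k. \<Prod>i\<in>I. divided_pow (y i) (v i))"
  using assms
proof (induction I arbitrary: k rule: finite_induct)
  case empty
  show ?case
    by (cases k) (simp_all add: divided_pow_def)
next
  case (insert j I)
  let ?V = "\<lambda>J k. {v. v \<in> J \<rightarrow>\<^sub>E (UNIV :: nat set) \<and> sum v J = k}"
  have fin: "finite (?V I k)" for k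
    by (rule finite_subset[OF _ finite_compositions[OF insert.hyps(1), of k]]) auto
  have upd: "(\<Sum>i\<in>I. if i = j then a else v i) = sum v I" for a :: nat and v
    using insert.hyps by (intro sum.cong) auto
  have upd': "(\<Prod>i\<in>I. divided_pow (y i) (if i = j then a else v i)) = (\<Prod>i\<in>I. divided_pow (y i) (v i))" for a v
    using insert.hyps by (intro prod.cong) auto
  have "divided_pow (\<Sum>i\<in>insert j I. y i) k = (\<Sum>a\<le>k. \<Sum>v\<in>?V I (k - a). divided_pow (y j) a * (\<Prod>i\<in>I. divided_pow (y i) (v i)))"
    using insert by (simp add: divided_pow_add sum_distrib_left)
  also have "\<dots> = (\<Sum>(a, v)\<in>(SIGMA a:{..k}. ?V I (k - a)). divided_pow (y j) a * (\<Prod>i\<in>I. divided_pow (y i) (v i)))"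
    using fin by (subst sum.Sigma) auto
  also have "\<dots> = (\<Sum>v\<in>?V (insert j I) k. \<Prod>i\<in>insert j I. divided_pow (y i) (v i))"
  \<comment> \<open>A tuple on \<open>insert j I\<close> corresponds to its value at j and its
    restriction to I; resetting j to \<open>undefined\<close> keeps the restriction
    extensional.\<close>
  proof (rule sum.reindex_bij_witness[of _ "\<lambda>v. (v j, v(j := undefined))" "\<lambda>(a, v). v(j := a)"])
    fix p assume "p \<in> (SIGMA a:{..k}. ?V I (k - a))"
    then obtain a w where p: "p = (a, w)" "a \<le> k" "w \<in> I \<rightarrow>\<^sub>E UNIV" "sum w I = k - a"
      by auto
    show "((case p of (a, v) \<Rightarrow> v(j := a)) j, (case p of (a, v) \<Rightarrow> v(j := a))(j := undefined)) = p"
      using p insert.hyps by (auto simp: PiE_iff extensional_def fun_eq_iff)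
    show "(case p of (a, v) \<Rightarrow> v(j := a)) \<in> ?V (insert j I) k"
      using p insert.hyps by (auto simp: PiE_iff extensional_def upd)
    show "(\<Prod>i\<in>insert j I. divided_pow (y i) ((case p of (a, v) \<Rightarrow> v(j := a)) i)) =
        (case p of (a, v) \<Rightarrow> divided_pow (y j) a * (\<Prod>i\<in>I. divided_pow (y i) (v i)))"
      using p insert.hyps by (simp add: upd')
  next
    fix v assume v: "v \<in> ?V (insert j I) k"
    then show "(case (v j, v(j := undefined)) of (a, v) \<Rightarrow> v(j := a)) = v"
      by simp
    show "(v j, v(j := undefined)) \<in> (SIGMA a:{..k}. ?V I (k - a))"
      using v insert.hyps by (auto simp: PiE_iff extensional_def upd)
  qed
  finally show ?case .
qed

lemma fps_const_prod: "fps_const (\<Prod>i\<in>A. f i) = (\<Prod>i\<in>A. fps_const (f i :: 'a::comm_ring_1))"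
  by (induction A rule: infinite_finite_induct) (simp_all flip: fps_const_mult)

text \<open>With k the sum of the entries, the falling factorial in the numerator is k! times a
  generalized binomial coefficient. Only that factor depends on \<alpha>; the rest is an ordinary
  multinomial coefficient.\<close>

lemma multinom_conv_gbinomial:
  "multinom m \<alpha> v = (\<alpha> gchoose (\<Sum>i = 1..m - 1. v i)) * fact (\<Sum>i = 1..m - 1. v i) * (\<Prod>i = 1..m - 1. inverse (fact (v i)))"
proof -
  have "(\<Prod>i = 1..m - 1. inverse (fact (v i) :: complex)) = inverse (\<Prod>i = 1..m - 1. fact (v i))"
    using prod_inversef[of "\<lambda>i. fact (v i) :: complex"] by (simp only: o_def)
  then show ?thesis
    unfolding multinom_def by (simp only: gbinomial_mult_fact' divide_inverse atLeast0LessThan)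
qed

text \<open>The multinomial theorem at y_i = y^i, where each monomial collapses to y to the power r.
  This is the k-th term of the binomial expansion of (1 + y + ... + y^(m-1))^\<alpha>.\<close>

lemma gbinomial_times_power_sum:
  fixes y :: "complex fps"
  shows "fps_const (\<alpha> gchoose k) * (\<Sum>i = 1..m - 1. y ^ i) ^ k =
    (\<Sum>v | v \<in> tuples m \<and> (\<Sum>i = 1..m - 1. v i) = k. fps_const (multinom m \<alpha> v) * y ^ weight m v)"
proof -
  have "fps_const (\<alpha> gchoose k) * (\<Sum>i = 1..m - 1. y ^ i) ^ k =
      fps_const ((\<alpha> gchoose k) * fact k) * divided_pow (\<Sum>i = 1..m - 1. y ^ i) k"
    by (simp add: divided_pow_def flip: mult.assoc)
  also have "\<dots> = (\<Sum>v | v \<in> tuples m \<and> (\<Sum>i = 1..m - 1. v i) = k.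
      fps_const ((\<alpha> gchoose k) * fact k) * (\<Prod>i = 1..m - 1. divided_pow (y ^ i) (v i)))"
    by (simp add: divided_pow_sum tuples_def sum_distrib_left)
  also have "\<dots> = (\<Sum>v | v \<in> tuples m \<and> (\<Sum>i = 1..m - 1. v i) = k. fps_const (multinom m \<alpha> v) * y ^ weight m v)"
  proof (rule sum.cong[OF refl], safe)
    fix v
    have "(\<Prod>i = 1..m - 1. divided_pow (y ^ i) (v i)) = fps_const (\<Prod>i = 1..m - 1. inverse (fact (v i))) * y ^ weight m v"
      by (simp add: divided_pow_def prod.distrib weight_def power_sum fps_const_prod flip: power_mult)
    then show "fps_const ((\<alpha> gchoose sum v {1..m - 1}) * fact (sum v {1..m - 1})) * (\<Prod>i = 1..m - 1. divided_pow (y ^ i) (v i))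
      = fps_const (multinom m \<alpha> v) * y ^ weight m v"
      unfolding multinom_conv_gbinomial by (simp only: mult.assoc flip: fps_const_mult)
  qed
  finally show ?thesis .
qed

lemma sum_le_weight: "(\<Sum>i = 1..m - 1. v i) \<le> weight m v"
  unfolding weight_def by (rule sum_mono) simp

lemma finite_tuples_sum_le: "finite {v \<in> tuples m. (\<Sum>i = 1..m - 1. v i) \<le> k}"
  unfolding tuples_def by (rule finite_compositions) simp

lemma finite_tuples_weight_le: "finite {v \<in> tuples m. weight m v \<le> k}"
  by (rule finite_subset[OF _ finite_tuples_sum_le[of m k]]) (use sum_le_weight order_trans in blast)

text \<open>For a natural exponent the binomial expansion is finite, so \<open>y\<close> may have a
  nonzero constant term, as -lam e^z has for nonzero lam.\<close>

lemma power_of_power_sum: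
  fixes y :: "complex fps"
  shows "(1 + (\<Sum>i = 1..m - 1. y ^ i)) ^ k =
    (\<Sum>v | v \<in> tuples m \<and> (\<Sum>i = 1..m - 1. v i) \<le> k. fps_const (multinom m (of_nat k) v) * y ^ weight m v)"
proof -
  have "(1 + (\<Sum>i = 1..m - 1. y ^ i)) ^ k = (\<Sum>j\<le>k. fps_const (of_nat k gchoose j) * (\<Sum>i = 1..m - 1. y ^ i) ^ j)"
    by (subst add.commute, subst binomial_ring)
      (simp add: fps_of_nat flip: binomial_gbinomial)
  also have "\<dots> = (\<Sum>j\<le>k. \<Sum>v | v \<in> {v \<in> tuples m. (\<Sum>i = 1..m - 1. v i) \<le> k} \<and> (\<Sum>i = 1..m - 1. v i) = j.
      fps_const (multinom m (of_nat k) v) * y ^ weight m v)"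
    unfolding gbinomial_times_power_sum by (intro sum.cong refl) auto
  also have "\<dots> = (\<Sum>v | v \<in> tuples m \<and> (\<Sum>i = 1..m - 1. v i) \<le> k. fps_const (multinom m (of_nat k) v) * y ^ weight m v)"
    by (rule sum.group[OF finite_tuples_sum_le]) auto
  finally show ?thesis .
qed

text \<open>These are the coefficients a(r) of A(t), for arbitrary \<alpha>. The inner series has
  zero constant term, so its powers beyond the r-th do not reach coefficient r, and the multinomial
  theorem is applied to finitely many powers.\<close>

lemma fps_nth_binomial_compose_power_sum:
  "fps_nth (fps_binomial \<alpha> oo (\<Sum>i = 1..m - 1. fps_X ^ i)) r = (\<Sum>v | v \<in> tuples m \<and> weight m v = r. multinom m \<alpha> v)"
proof -
  let ?g = "\<Sum>i = 1..m - 1. fps_X ^ i :: complex fps"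
  have "fps_nth (fps_binomial \<alpha> oo ?g) r = (\<Sum>k = 0..r. fps_nth (fps_const (\<alpha> gchoose k) * ?g ^ k) r)"
    by (simp add: fps_compose_nth)
  also have "\<dots> = (\<Sum>k = 0..r. \<Sum>v | v \<in> tuples m \<and> (\<Sum>i = 1..m - 1. v i) = k.
      if weight m v = r then multinom m \<alpha> v else 0)"
    unfolding gbinomial_times_power_sum by (auto simp: fps_sum_nth intro!: sum.cong)
  also have "\<dots> = (\<Sum>k = 0..r. \<Sum>v | v \<in> {v \<in> tuples m. (\<Sum>i = 1..m - 1. v i) \<le> r} \<and> (\<Sum>i = 1..m - 1. v i) = k.
      if weight m v = r then multinom m \<alpha> v else 0)"
    by (intro sum.cong refl) auto
  also have "\<dots> = (\<Sum>v | v \<in> tuples m \<and> (\<Sum>i = 1..m - 1. v i) \<le> r. if weight m v = r then multinom m \<alpha> v else 0)"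
    by (rule sum.group[OF finite_tuples_sum_le]) auto
  also have "\<dots> = (\<Sum>v | v \<in> tuples m \<and> weight m v = r. multinom m \<alpha> v)"
    \<comment> \<open>A tuple of weight r has entry sum at most r, so the truncation at r loses none
      of them.\<close>
    using sum_le_weight[of _ m] by (intro sum.mono_neutral_cong_right finite_tuples_sum_le) auto
  finally show ?thesis .
qed

section \<open>Complex powers of formal power series\<close>

text \<open>The power f^\<alpha> of a series with constant term 1. No branch has to be chosen, so
  the usual power laws hold; the principal value of a general constant term is kept apart.\<close>

definition normalized_cpow :: "complex \<Rightarrow> complex fps \<Rightarrow> complex fps" where
  "normalized_cpow \<alpha> f = fps_binomial \<alpha> oo (f - 1)"

lemma normalized_cpow_nth_0 [simp]: "fps_nth (normalized_cpow \<alpha> f) 0 = 1"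
  by (simp add: normalized_cpow_def fps_compose_nth)

text \<open>The binomial series B satisfies (1 + z) B' = \<alpha> B; substituting f - 1 for z and
  applying the chain rule gives the equation f g' = \<alpha> f' g.\<close>

lemma normalized_cpow_deriv:
  assumes "fps_nth f 0 = 1"
  shows "f * fps_deriv (normalized_cpow \<alpha> f) = fps_const \<alpha> * fps_deriv f * normalized_cpow \<alpha> f"
proof -
  have "(1 + fps_X) * fps_deriv (fps_binomial \<alpha>) = fps_const \<alpha> * fps_binomial \<alpha>"
    using inverse_mult_eq_1'[of "1 + fps_X :: complex fps"]
    by (simp add: fps_binomial_deriv fps_divide_unit mult.left_commute[of "1 + fps_X"])
  then have "((1 + fps_X) * fps_deriv (fps_binomial \<alpha>)) oo (f - 1) = (fps_const \<alpha> * fps_binomial \<alpha>) oo (f - 1)"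
    by simp
  then have "f * (fps_deriv (fps_binomial \<alpha>) oo (f - 1)) = fps_const \<alpha> * normalized_cpow \<alpha> f"
    using assms by (simp add: fps_compose_mult_distrib fps_compose_add_distrib normalized_cpow_def)
  then show ?thesis
    using assms by (simp add: normalized_cpow_def fps_compose_deriv)
qed

text \<open>The quotient of two solutions has derivative 0 and constant term 1.\<close>

lemma normalized_cpow_unique:
  assumes "fps_nth f 0 = 1" "fps_nth g 0 = 1" "f * fps_deriv g = fps_const \<alpha> * fps_deriv f * g"
  shows "g = normalized_cpow \<alpha> f"
proof -
  let ?w = "normalized_cpow \<alpha> f"
  have f: "f \<noteq> 0" and w: "fps_nth ?w 0 \<noteq> 0" "?w \<noteq> 0"
    using assms(1) normalized_cpow_nth_0[of \<alpha> f] by (metis fps_zero_nth zero_neq_one)+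
  have "f * (fps_deriv g * ?w) = (f * fps_deriv g) * ?w"
    by (simp only: mult.assoc)
  also have "\<dots> = g * (fps_const \<alpha> * fps_deriv f * ?w)"
    unfolding assms(3) by (simp only: mult_ac)
  also have "\<dots> = f * (g * fps_deriv ?w)"
    unfolding normalized_cpow_deriv[OF assms(1), symmetric] by (simp only: mult_ac)
  finally have "f * (fps_deriv g * ?w) = f * (g * fps_deriv ?w)" .
  then have "fps_deriv g * ?w = g * fps_deriv ?w"
    using f by simp
  \<comment> \<open>Divided by the square of \<open>?w\<close>, the Wronskian is the derivative of
    the quotient of g by \<open>?w\<close>.\<close>
  then have "(fps_deriv g * ?w - g * fps_deriv ?w) * inverse ?w ^ 2 = 0"
    by simp
  moreover have inv: "?w * inverse ?w = 1"
    using w(1) by (rule inverse_mult_eq_1')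
  moreover have "fps_deriv (inverse ?w) = - fps_deriv ?w * (inverse ?w)\<^sup>2"
    using w(1) by (rule fps_inverse_deriv)
  ultimately have "fps_deriv (g * inverse ?w) = 0"
    unfolding fps_deriv_mult by algebra
  then have "g * inverse ?w = fps_const (fps_nth (g * inverse ?w) 0)"
    by (simp only: fps_deriv_eq_0_iff)
  also have "fps_nth (g * inverse ?w) 0 = 1"
    using assms(2) by simp
  finally have "g * inverse ?w * ?w = ?w"
    by simp
  then show ?thesis
    using inv by (simp only: mult.assoc mult.commute[of "inverse ?w"] mult_1_right)
qed

text \<open>By the product rule, the product of the two powers solves the differential equation that
  characterizes the power of f * g.\<close>

lemma normalized_cpow_mult:
  assumes "fps_nth f 0 = 1" "fps_nth g 0 = 1"
  shows "normalized_cpow \<alpha> (f * g) = normalized_cpow \<alpha> f * normalized_cpow \<alpha> g"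
proof (rule normalized_cpow_unique[symmetric])
  show "f * g * fps_deriv (normalized_cpow \<alpha> f * normalized_cpow \<alpha> g) = fps_const \<alpha> * fps_deriv (f * g) * (normalized_cpow \<alpha> f * normalized_cpow \<alpha> g)"
    using normalized_cpow_deriv[OF assms(1), of \<alpha>] normalized_cpow_deriv[OF assms(2), of \<alpha>]
    unfolding fps_deriv_mult by algebra
qed (use assms in auto)

lemma normalized_cpow_compose:
  assumes "fps_nth f 0 = 1" "fps_nth h 0 = 0"
  shows "normalized_cpow \<alpha> f oo h = normalized_cpow \<alpha> (f oo h)"
  using assms fps_compose_assoc[of h "f - 1" "fps_binomial \<alpha>"]
  by (simp add: normalized_cpow_def fps_compose_sub_distrib)

lemma fps_cpow_eq_normalized_cpow:
  "fps_nth f 0 \<noteq> 0 \<Longrightarrow> fps_cpow f \<alpha> = fps_const (fps_nth f 0 powr \<alpha>) * normalized_cpow \<alpha> (fps_const (inverse (fps_nth f 0)) * f)"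
  by (simp add: fps_cpow_unit normalized_cpow_def)

section \<open>Factorization of the Genocchi generating function and of its powers\<close>

lemma sum_power_eq_1_plus:
  "m > 0 \<Longrightarrow> (\<Sum>i<m. y ^ i) = 1 + (\<Sum>i = 1..m - 1. y ^ i :: 'a :: comm_ring_1)"
  by (cases m) (simp_all add: sum.atLeast1_atMost_eq sum.lessThan_Suc_shift del: sum.lessThan_Suc)

text \<open>The leading 1 stands apart to match 1 + y_1 + ... + y_(m-1) in the multinomial
  expansion.\<close>

definition power_sum :: "nat \<Rightarrow> complex fps \<Rightarrow> complex fps" where
  "power_sum m y = 1 + (\<Sum>i = 1..m - 1. y ^ i)"

lemma power_sum_eq: "m > 0 \<Longrightarrow> power_sum m y = (\<Sum>i<m. y ^ i)"
  by (simp add: power_sum_def sum_power_eq_1_plus)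

text \<open>Both sides agree after multiplication by lam e^z + 1. This series is nonzero for every
  lam, hence can be cancelled even where it is not a unit.\<close>

lemma genocchi_base_eq:
  assumes "even m" "m > 0"
  shows "genocchi_base lam = fps_const (- 2 / of_nat m) *
    (bernoulli_base (lam ^ m) oo (fps_const (of_nat m) * fps_X)) * power_sum m (fps_const (- lam) * fps_exp 1)"
proof -
  let ?mX = "fps_const (of_nat m) * fps_X :: complex fps"
  let ?d = "fps_const lam * fps_exp 1 + 1"
  let ?B = "bernoulli_base (lam ^ m) oo ?mX"
  let ?y = "fps_const (- lam) * fps_exp 1"
  have d: "?d \<noteq> 0"
    using subdegree_apostol_denom_le_1(1)[of 1 lam] by simp
  \<comment> \<open>The equation defining the Bernoulli base, with mz substituted for z.\<close>
  have "(bernoulli_base (lam ^ m) * (fps_const (lam ^ m) * fps_exp 1 - 1)) oo ?mX = fps_X oo ?mX"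
    by (simp only: bernoulli_base_times)
  then have B: "?B * (fps_const (lam ^ m) * fps_exp (of_nat m) - 1) = ?mX"
    by (simp add: fps_compose_mult_distrib fps_compose_sub_distrib)
  have "?y ^ m = fps_const (lam ^ m) * fps_exp (of_nat m)"
    using assms by (simp add: power_mult_distrib fps_exp_power_mult fps_const_power del: fps_const_neg)
  moreover have "?d = 1 - ?y"
    by (simp flip: fps_const_neg)
  ultimately have S: "power_sum m ?y * ?d = - (fps_const (lam ^ m) * fps_exp (of_nat m) - 1)"
    using assms one_diff_power_eq[of ?y m] by (simp add: power_sum_eq mult.commute)
  have "(fps_const (- 2 / of_nat m) * ?B * power_sum m ?y) * ?d
     = - (fps_const (- 2 / of_nat m) * (?B * (fps_const (lam ^ m) * fps_exp (of_nat m) - 1)))"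
    unfolding mult.assoc S by (simp only: mult_minus_right)
  also have "\<dots> = - (fps_const (- 2 / of_nat m * of_nat m) * fps_X)"
    unfolding B by (simp only: mult.assoc flip: fps_const_mult)
  also have "\<dots> = 2 * fps_X"
    using assms by (simp add: fps_numeral_fps_const flip: fps_const_neg)
  also have "\<dots> = genocchi_base lam * ?d"
    by (simp add: genocchi_base_times)
  finally show ?thesis
    using d by simp
qed

lemma bernoulli_base_1_nth_0: "fps_nth (bernoulli_base 1) 0 = 1"
  using arg_cong [OF bernoulli_base_times [of 1], of "\<lambda>f. fps_nth f 1"]
  by (simp add: fps_mult_nth)

text \<open>Principal powers need not be multiplicative, so for non-natural \<alpha> the constant
  terms are treated separately: the left side contributes (-2)^\<alpha>, the geometric sum
  m^\<alpha>, and the Bernoulli factor 1. Hence the compensating m^(-\<alpha>).\<close>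

lemma fps_cpow_genocchi_base:
  assumes "even m" "m > 0" "fps_has_cpow (genocchi_base lam) \<alpha>"
  shows "fps_cpow (genocchi_base lam) \<alpha> = fps_const ((- 2) powr \<alpha> * of_nat m powr (- \<alpha>)) *
    (fps_cpow (bernoulli_base (lam ^ m)) \<alpha> oo (fps_const (of_nat m) * fps_X)) *
    fps_cpow (power_sum m (fps_const (- lam) * fps_exp 1)) \<alpha>"
proof (cases "\<alpha> \<in> \<nat>")
  case True
  then obtain k where k: "\<alpha> = of_nat k" by (auto elim: Nats_cases)
  have "(- 2) powr \<alpha> * of_nat m powr (- \<alpha>) = (- 2 / of_nat m :: complex) ^ k"
    using assms by (simp add: k powr_nat' powr_minus power_divide power_mult_distrib[symmetric] divide_inverse flip: power_inverse)
  then show ?thesis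
    unfolding k fps_cpow_of_nat genocchi_base_eq[OF assms(1,2)]
    by (simp add: power_mult_distrib fps_compose_power fps_const_power)
next
  case False
  then have lam: "lam = - 1"
    using assms by (simp add: fps_has_cpow_genocchi_base_iff)
  let ?mX = "fps_const (of_nat m) * fps_X :: complex fps"
  let ?B = "bernoulli_base 1"
  let ?S = "power_sum m (fps_exp 1)"
  have S0: "fps_nth ?S 0 = of_nat m"
    using assms by (simp add: power_sum_eq fps_sum_nth fps_power_zeroth)
  have eq: "genocchi_base lam = fps_const (- 2 / of_nat m) * (?B oo ?mX) * ?S"
    using genocchi_base_eq[OF assms(1,2), of lam] assms(1) by (simp add: lam)
  then have g0: "fps_nth (genocchi_base lam) 0 = - 2"
    using assms S0 by (simp add: bernoulli_base_1_nth_0)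
  \<comment> \<open>After division by the constant term -2, the factors can be arranged to have
    constant term 1, and normalized powers multiply.\<close>
  have "fps_const (inverse (- 2)) * genocchi_base lam = fps_const (inverse (- 2) * (- 2 / of_nat m)) * (?B oo ?mX) * ?S"
    unfolding eq by (simp only: mult.assoc flip: fps_const_mult)
  also have "inverse (- 2) * (- 2 / of_nat m) = inverse (of_nat m :: complex)"
    by (simp add: field_simps)
  also have "fps_const (inverse (of_nat m)) * (?B oo ?mX) * ?S = (?B oo ?mX) * (fps_const (inverse (of_nat m)) * ?S)"
    by (simp only: mult.assoc mult.left_commute)
  finally have "normalized_cpow \<alpha> (fps_const (inverse (- 2)) * genocchi_base lam) =
      normalized_cpow \<alpha> (?B oo ?mX) * normalized_cpow \<alpha> (fps_const (inverse (of_nat m)) * ?S)"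
    using assms by (simp add: normalized_cpow_mult bernoulli_base_1_nth_0 S0)
  moreover have "normalized_cpow \<alpha> (?B oo ?mX) = fps_cpow ?B \<alpha> oo ?mX"
    by (simp add: fps_cpow_eq_normalized_cpow normalized_cpow_compose bernoulli_base_1_nth_0)
  moreover have "fps_cpow ?S \<alpha> = fps_const (of_nat m powr \<alpha>) * normalized_cpow \<alpha> (fps_const (inverse (of_nat m)) * ?S)"
    using assms by (simp add: fps_cpow_eq_normalized_cpow S0)
  then have "normalized_cpow \<alpha> (fps_const (inverse (of_nat m)) * ?S) = fps_const (of_nat m powr (- \<alpha>)) * fps_cpow ?S \<alpha>"
    using assms by (simp add: powr_minus mult.assoc[symmetric] del: fps_const_mult)
  moreover have "fps_cpow (genocchi_base lam) \<alpha> = fps_const ((- 2) powr \<alpha>) * normalized_cpow \<alpha> (fps_const (inverse (- 2)) * genocchi_base lam)"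
    by (simp add: fps_cpow_eq_normalized_cpow g0)
  moreover have "fps_const (- lam) * fps_exp 1 = fps_exp 1" "lam ^ m = 1"
    using assms(1) by (simp_all add: lam)
  ultimately show ?thesis
    by (simp only: mult.assoc mult.left_commute flip: fps_const_mult)
qed

section \<open>Boundary behaviour of powers of a geometric sum\<close>

text \<open>The sum is (1 - t^m)/(1 - t) with numerator and denominator in the right half-plane, so
  their arguments differ by less than pi. Hence the principal power of the sum is holomorphic on the
  unit disc.\<close>

lemma geometric_sum_notin_nonpos_Reals:
  fixes t :: complex
  assumes "m > 0" "norm t < 1"
  shows "(\<Sum>i<m. t ^ i) \<notin> \<real>\<^sub>\<le>\<^sub>0"
proof -
  have pos: "0 < Re (1 - w)" if "norm w < 1" for w :: complex
    using that complex_Re_le_cmod[of w] by simp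
  have "norm (t ^ m) < 1"
    using assms power_less_one_iff[of "norm t" m] by (simp add: norm_power)
  from pos[OF this] pos[OF assms(2)] have *: "0 < Re (1 - t ^ m)" "0 < Re (1 - t)" .
  then have nz: "1 - t ^ m \<noteq> 0" "1 - t \<noteq> 0"
    by (metis less_irrefl zero_complex.simps(1))+
  let ?w = "Ln (1 - t ^ m) - Ln (1 - t)"
  have S: "(\<Sum>i<m. t ^ i) = (1 - t ^ m) / (1 - t)"
    using nz by (simp add: one_diff_power_eq[of t m])
  have "\<bar>Im (Ln (1 - t ^ m))\<bar> < pi / 2" "\<bar>Im (Ln (1 - t))\<bar> < pi / 2"
    using * nz Re_Ln_pos_lt by blast+
  then have Im: "- pi < Im ?w" "Im ?w < pi"
    by auto
  have "exp ?w = (\<Sum>i<m. t ^ i)"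
    using nz by (simp add: exp_diff S)
  then have "Ln (\<Sum>i<m. t ^ i) = ?w"
    using Im by (intro Ln_unique) auto
  moreover have "(\<Sum>i<m. t ^ i) \<noteq> 0"
    using nz S by simp
  moreover have "Im (Ln s) = pi" if "s \<in> \<real>\<^sub>\<le>\<^sub>0" "s \<noteq> 0" for s
    using that Im_Ln_eq_pi[of s] by (auto simp: complex_nonpos_Reals_iff complex_eq_iff)
  ultimately show ?thesis
    using Im(2) by (metis less_irrefl)
qed

section \<open>The operator t d/dt and the substitution t = e^z\<close>

definition euler_deriv :: "complex fps \<Rightarrow> complex fps" where
  "euler_deriv f = fps_X * fps_deriv f"

lemma fps_nth_euler_deriv_iter: "fps_nth ((euler_deriv ^^ k) f) r = of_nat r ^ k * fps_nth f r"
  by (induction k arbitrary: r) (auto simp: euler_deriv_def)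

lemma fps_conv_radius_euler_deriv_iter: "fps_conv_radius ((euler_deriv ^^ k) f) \<ge> fps_conv_radius f"
proof (induction k)
  case (Suc k)
  have "fps_conv_radius (fps_X * fps_deriv g) \<ge> fps_conv_radius g" for g :: "complex fps"
    using fps_conv_radius_mult[of fps_X "fps_deriv g"] fps_conv_radius_deriv[of g] by simp
  with Suc show ?case
    by (auto simp: euler_deriv_def intro: order_trans)
qed auto

text \<open>By the chain rule, d/dz acts on F(e^z) as t d/dt acts on F. The condition Re z < 0
  places e^z in the open unit disc, where the series converges.\<close>

lemma higher_deriv_eval_fps_exp:
  assumes F: "fps_conv_radius F \<ge> 1" and "Re z < 0"
  shows "(deriv ^^ k) (\<lambda>z. eval_fps F (exp z)) z = eval_fps ((euler_deriv ^^ k) F) (exp z)"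
  using assms(2)
proof (induction k arbitrary: z)
  case (Suc k)
  let ?G = "(euler_deriv ^^ k) F"
  have "eventually (\<lambda>w. w \<in> {w. Re w < 0}) (nhds z)"
    using Suc.prems by (intro eventually_nhds_in_open open_halfspace_Re_lt) auto
  then have "eventually (\<lambda>w. (deriv ^^ k) (\<lambda>z. eval_fps F (exp z)) w = eval_fps ?G (exp w)) (nhds z)"
    by eventually_elim (use Suc.IH in auto)
  then have "(deriv ^^ Suc k) (\<lambda>z. eval_fps F (exp z)) z = deriv (\<lambda>w. eval_fps ?G (exp w)) z"
    by (simp add: deriv_cong_ev)
  moreover have "ereal (norm (exp z)) < fps_conv_radius ?G"
  proof -
    have "ereal (norm (exp z)) < 1"
      using Suc.prems by simp
    also have "\<dots> \<le> fps_conv_radius ?G"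
      using F fps_conv_radius_euler_deriv_iter order_trans by blast
    finally show ?thesis .
  qed
  then have r: "ereal (norm (exp z)) < fps_conv_radius ?G" "ereal (norm (exp z)) < fps_conv_radius (fps_deriv ?G)"
    using fps_conv_radius_deriv[of ?G] by (auto intro: less_le_trans)
  have "(eval_fps ?G has_field_derivative eval_fps (fps_deriv ?G) (exp z)) (at (exp z))"
    using r(1) by (intro has_field_derivative_eval_fps)
  from DERIV_chain2[OF this DERIV_exp] have "deriv (\<lambda>w. eval_fps ?G (exp w)) z = eval_fps (fps_deriv ?G) (exp z) * exp z"
    by (rule DERIV_imp_deriv)
  moreover have "eval_fps ((euler_deriv ^^ Suc k) F) (exp z) = exp z * eval_fps (fps_deriv ?G) (exp z)"
    using r(2) by (simp add: euler_deriv_def eval_fps_mult)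
  ultimately show ?case
    by (simp add: mult.commute)
qed simp

text \<open>\<open>F\<close> is the expansion of the principal power A of 1 + t + ... + t^(m-1),
  which is holomorphic on the unit disc; this bounds the radius. The point t = 1 may lie on the
  boundary, but H(z) = A(e^z) is holomorphic near 0, so its k-th derivative is continuous
  there.\<close>

lemma tendsto_eval_euler_deriv_power_sum:
  fixes \<alpha> :: complex and m :: nat
  defines "F \<equiv> fps_binomial \<alpha> oo (\<Sum>i = 1..m - 1. fps_X ^ i)"
  assumes m: "m > 0"
  shows "fps_conv_radius F \<ge> 1"
    and "((\<lambda>t. eval_fps ((euler_deriv ^^ k) F) (of_real t)) \<longlongrightarrow>
           fact k * fps_nth (fps_cpow (\<Sum>i<m. fps_exp 1 ^ i) \<alpha>) k) (at_left (1::real))"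
proof -
  define A where "A t = (\<Sum>i<m. t ^ i) powr \<alpha>" for t :: complex
  define H where "H z = A (exp z)" for z
  have "((\<lambda>u. (1 + u) powr \<alpha>) \<circ> (\<lambda>t. \<Sum>i = 1..m - 1. t ^ i)) has_fps_expansion F"
    unfolding F_def
    by (intro has_fps_expansion_compose fps_expansion_intros) (simp add: fps_sum_nth)
  then have AF: "A has_fps_expansion F"
    by (simp add: A_def[abs_def] sum_power_eq_1_plus[OF m] o_def)
  have holA: "A holomorphic_on ball 0 1"
    unfolding A_def[abs_def] using geometric_sum_notin_nonpos_Reals[OF m]
    by (intro holomorphic_intros) auto
  show F1: "fps_conv_radius F \<ge> 1"
    using holomorphic_on_imp_fps_conv_radius_ge[OF AF, of 1] holA by (simp add: one_ereal_def)
  have evA: "eval_fps F t = A t" if "norm t < 1" for t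
    using has_fps_expansion_imp_eval_fps_eq[OF AF that holA] .

  \<comment> \<open>At z = 0 the sum is m > 0, off the branch cut. So \<open>U\<close> is a
    neighbourhood of 0 on which H is holomorphic beyond the half-plane Re z < 0.\<close>
  define U where "U = {z::complex. (\<Sum>i<m. exp z ^ i) \<notin> \<real>\<^sub>\<le>\<^sub>0}"
  have "open ((\<lambda>z::complex. \<Sum>i<m. exp z ^ i) -` (- \<real>\<^sub>\<le>\<^sub>0))"
    by (intro open_vimage continuous_intros) (auto simp: open_Compl)
  then have U: "open U" "0 \<in> U"
    using m by (auto simp: U_def vimage_def)
  have holH: "H holomorphic_on U"
    unfolding H_def[abs_def] A_def[abs_def] U_def by (intro holomorphic_intros) auto
  have eq: "(deriv ^^ k) H z = eval_fps ((euler_deriv ^^ k) F) (exp z)" if "Re z < 0" for z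
  proof -
    have "eventually (\<lambda>w. w \<in> {w. Re w < 0}) (nhds z)"
      using that by (intro eventually_nhds_in_open open_halfspace_Re_lt) auto
    then have "eventually (\<lambda>w. H w = eval_fps F (exp w)) (nhds z)"
      by eventually_elim (simp add: H_def evA)
    then have "(deriv ^^ k) H z = (deriv ^^ k) (\<lambda>z. eval_fps F (exp z)) z"
      by (rule higher_deriv_cong_ev) simp
    then show ?thesis
      using higher_deriv_eval_fps_exp[OF F1 that] by simp
  qed
  have "(deriv ^^ k) H holomorphic_on U"
    by (rule holomorphic_higher_deriv[OF holH U(1)])
  then have "isCont ((deriv ^^ k) H) 0"
    using U holomorphic_on_imp_continuous_on continuous_on_eq_continuous_at by blast
  \<comment> \<open>The point 0 is approached along z = ln t, which is negative for 0 < t <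
    1.\<close>
  moreover have "(ln \<longlongrightarrow> ln 1) (at_left (1::real))"
    by (rule tendsto_ln) (auto intro: tendsto_ident_at)
  then have "((\<lambda>t. complex_of_real (ln t)) \<longlongrightarrow> 0) (at_left 1)"
    by (auto dest: tendsto_of_real[where 'a = complex])
  ultimately have "((\<lambda>t. (deriv ^^ k) H (of_real (ln t))) \<longlongrightarrow> (deriv ^^ k) H 0) (at_left 1)"
    by (rule isCont_tendsto_compose)
  moreover have "eventually (\<lambda>t. (deriv ^^ k) H (of_real (ln t)) = eval_fps ((euler_deriv ^^ k) F) (of_real t)) (at_left 1)"
    using eq by (intro eventually_at_leftI[of 0]) (auto simp: exp_of_real)
  ultimately have lim: "((\<lambda>t. eval_fps ((euler_deriv ^^ k) F) (of_real t)) \<longlongrightarrow> (deriv ^^ k) H 0) (at_left 1)"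
    using tendsto_cong by force

  let ?S = "\<Sum>i<m. fps_exp 1 ^ i :: complex fps"
  have S0: "fps_nth ?S 0 = of_nat m"
    by (simp add: fps_sum_nth fps_power_zeroth)
  \<comment> \<open>The geometric sum divided by its value m at 0, minus 1: the argument of the
    binomial series in \<open>fps_cpow\<close>.\<close>
  define u where "u z = inverse (of_nat m) * (\<Sum>i<m. exp (1 * z) ^ i) - 1" for z :: complex
  have u: "u has_fps_expansion (fps_const (inverse (of_nat m)) * ?S - 1)"
    unfolding u_def[abs_def] by (intro fps_expansion_intros)
  have "((\<lambda>u. (1 + u) powr \<alpha>) \<circ> u) has_fps_expansion (fps_binomial \<alpha> oo (fps_const (inverse (of_nat m)) * ?S - 1))"
    using m S0 by (intro has_fps_expansion_compose has_fps_expansion_binomial_complex u) simp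
  then have "(\<lambda>z. of_nat m powr \<alpha> * ((\<lambda>u. (1 + u) powr \<alpha>) \<circ> u) z) has_fps_expansion fps_cpow ?S \<alpha>"
    using m S0 by (subst fps_cpow_unit) (simp_all only: has_fps_expansion_cmult_left of_nat_eq_0_iff neq0_conv not_False_eq_True)
  moreover have "eventually (\<lambda>z. z \<in> U) (nhds 0)"
    using U by (intro eventually_nhds_in_open)
  then have "eventually (\<lambda>z. of_nat m powr \<alpha> * ((\<lambda>u. (1 + u) powr \<alpha>) \<circ> u) z = H z) (nhds 0)"
  proof eventually_elim
    case (elim z)
    let ?s = "\<Sum>i<m. exp z ^ i"
    have s: "?s \<noteq> 0"
      using elim by (auto simp: U_def)
    \<comment> \<open>A positive factor leaves the argument unchanged, so the principal logarithm
      splits without a multiple of 2 pi i, and m^\<alpha> (s/m)^\<alpha> = s^\<alpha>.\<close>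
    have "Ln ?s = Ln (of_nat m) + Ln (inverse (of_nat m) * ?s)"
      using m s Ln_times_of_nat[of m "inverse (of_nat m) * ?s"] by (simp flip: mult.assoc)
    then show ?case
      using m s by (simp add: u_def H_def A_def powr_def distrib_left exp_add)
  qed
  ultimately have "H has_fps_expansion fps_cpow ?S \<alpha>"
    by (rule has_fps_expansion_cong[OF _ refl, THEN iffD1, rotated])
  from fps_nth_fps_expansion[OF this, of k] lim
  show "((\<lambda>t. eval_fps ((euler_deriv ^^ k) F) (of_real t)) \<longlongrightarrow>
           fact k * fps_nth (fps_cpow (\<Sum>i<m. fps_exp 1 ^ i) \<alpha>) k) (at_left (1::real))"
    by simp
qed

section \<open>The multiplication formula\<close>

text \<open>The sets of tuples of weight at most N are finite and eventually contain any given
  finite set of tuples.\<close>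

lemma has_sum_imp_tendsto_weight:
  assumes "(F has_sum s) (tuples m)"
  shows "(\<lambda>N. \<Sum>v \<in> {v \<in> tuples m. weight m v \<le> N}. F v) \<longlonglongrightarrow> s"
proof -
  have "filterlim (\<lambda>N. {v \<in> tuples m. weight m v \<le> N}) (finite_subsets_at_top (tuples m)) sequentially"
    unfolding filterlim_finite_subsets_at_top
  proof safe
    fix X assume X: "finite X" "X \<subseteq> tuples m"
    show "eventually (\<lambda>N. finite {v \<in> tuples m. weight m v \<le> N} \<and> X \<subseteq> {v \<in> tuples m. weight m v \<le> N} \<and>
        {v \<in> tuples m. weight m v \<le> N} \<subseteq> tuples m) sequentially"
      using eventually_ge_at_top[of "Max (weight m ` X)"]
    proof eventually_elim
      case (elim N)
      then have "weight m v \<le> N" if "v \<in> X" for v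
        using order_trans[OF Max_ge elim] X(1) that by simp
      then show ?case
        using X(2) finite_tuples_weight_le by auto
    qed
  qed
  with assms show ?thesis
    unfolding has_sum_def by (rule filterlim_compose)
qed

lemma fps_mult_compose_linear:
  "(f * g :: complex fps) oo (fps_const c * fps_X) = (f oo (fps_const c * fps_X)) * (g oo (fps_const c * fps_X))"
  by (rule fps_compose_mult_distrib) simp

text \<open>Since e^(mxz) is e^(xz) taken at mz, the exponential joins the rescaled Bernoulli
  factor, and only the power of the geometric sum is left to expand.\<close>

lemma apostol_genocchi_eq:
  assumes "even m" "m > 0" "fps_has_cpow (genocchi_base lam) \<alpha>"
  shows "apostol_genocchi n \<alpha> (of_nat m * x) lam = (- 2) powr \<alpha> * of_nat m powr (- \<alpha>) * fact n *
    fps_nth (((fps_cpow (bernoulli_base (lam ^ m)) \<alpha> * fps_exp x) oo (fps_const (of_nat m) * fps_X)) *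
      fps_cpow (power_sum m (fps_const (- lam) * fps_exp 1)) \<alpha>) n"
proof -
  have "fps_exp (of_nat m * x) = fps_exp x oo (fps_const (of_nat m) * fps_X)"
    by (simp add: mult.commute[of x])
  note eq = this fps_cpow_genocchi_base[OF assms]
  have "fps_cpow (genocchi_base lam) \<alpha> * fps_exp (of_nat m * x) = fps_const ((- 2) powr \<alpha> * of_nat m powr (- \<alpha>)) *
    (((fps_cpow (bernoulli_base (lam ^ m)) \<alpha> * fps_exp x) oo (fps_const (of_nat m) * fps_X)) *
      fps_cpow (power_sum m (fps_const (- lam) * fps_exp 1)) \<alpha>)"
    unfolding eq fps_mult_compose_linear by (simp only: mult_ac)
  note eq = this
  show ?thesis
    unfolding apostol_genocchi_def eq fps_mult_left_const_nth by (simp only: mult_ac)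
qed

lemma apostol_bernoulli_add:
  "apostol_bernoulli n \<alpha> (x + y) lam = fact n * fps_nth (fps_cpow (bernoulli_base lam) \<alpha> * fps_exp x * fps_exp y) n"
  by (simp add: apostol_bernoulli_def fps_exp_add_mult mult.assoc)

text \<open>The factor m^n is what the substitution of mz for z contributes to coefficient
  n.\<close>

lemma prefactor_eq:
  assumes "m > 0"
  shows "(- 2) powr \<alpha> * of_nat m powr (of_nat n - \<alpha>) = (- 2) powr \<alpha> * of_nat m powr (- \<alpha>) * (of_nat m :: complex) ^ n"
  using assms by (simp add: powr_diff powr_minus powr_nat' divide_inverse)

text \<open>Only tuples of entry sum at most k contribute. In each term e^(rz) is e^((r/m)z) taken
  at mz, which shifts the Bernoulli argument by r/m.\<close>

lemma has_sum_apostol_genocchi_nat: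
  fixes m n k :: nat and lam x :: complex
  assumes m: "even m" "m > 0"
  defines "F \<equiv> (\<lambda>v. multinom m (of_nat k) v * (- lam) ^ weight m v *
                  apostol_bernoulli n (of_nat k) (x + of_nat (weight m v) / of_nat m) (lam ^ m))"
  obtains s where "(F has_sum s) (tuples m)"
    "apostol_genocchi n (of_nat k) (of_nat m * x) lam = (- 2) powr (of_nat k) * of_nat m powr (of_nat n - of_nat k) * s"
proof
  let ?V = "{v \<in> tuples m. (\<Sum>i = 1..m - 1. v i) \<le> k}"
  let ?mX = "fps_const (of_nat m) * fps_X :: complex fps"
  define K where "K = fps_cpow (bernoulli_base (lam ^ m)) (of_nat k) * fps_exp x"
  let ?y = "fps_const (- lam) * fps_exp 1 :: complex fps"
  have z: "F v = 0" if "v \<in> tuples m - ?V" for v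
  proof -
    \<comment> \<open>The factor with j = k vanishes.\<close>
    have "(\<Prod>j < (\<Sum>i = 1..m - 1. v i). of_nat k - of_nat j :: complex) = 0"
      using that by (intro prod_zero) auto
    then show ?thesis
      by (simp add: F_def multinom_def)
  qed
  show "(F has_sum sum F ?V) (tuples m)"
    by (rule has_sum_finite_neutralI[OF finite_tuples_sum_le]) (use z in auto)
  have term_eq: "fact n * fps_nth ((K oo ?mX) * (fps_const (multinom m (of_nat k) v) * ?y ^ weight m v)) n = of_nat m ^ n * F v" for v
  proof -
    let ?r = "of_nat (weight m v) :: complex"
    have "?y ^ weight m v = fps_const ((- lam) ^ weight m v) * (fps_exp (?r / of_nat m) oo ?mX)"
      using m by (simp add: power_mult_distrib fps_exp_power_mult fps_const_power del: fps_const_neg)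
    note y = this
    have "(K oo ?mX) * (fps_const (multinom m (of_nat k) v) * ?y ^ weight m v) =
        fps_const (multinom m (of_nat k) v * (- lam) ^ weight m v) * ((K * fps_exp (?r / of_nat m)) oo ?mX)"
      unfolding y fps_mult_compose_linear fps_const_mult[symmetric] by (simp only: mult_ac)
    note eq = this
    show ?thesis
      unfolding eq unfolding F_def apostol_bernoulli_add fps_mult_left_const_nth fps_compose_linear fps_nth_Abs_fps K_def
      by (simp only: mult_ac)
  qed
  have "fact n * fps_nth ((K oo ?mX) * fps_cpow (power_sum m ?y) (of_nat k)) n =
      (\<Sum>v\<in>?V. fact n * fps_nth ((K oo ?mX) * (fps_const (multinom m (of_nat k) v) * ?y ^ weight m v)) n)"
    unfolding power_sum_def fps_cpow_of_nat power_of_power_sum by (simp only: sum_distrib_left fps_sum_nth)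
  also have "\<dots> = of_nat m ^ n * sum F ?V"
    by (simp only: term_eq sum_distrib_left)
  finally have eq: "fact n * fps_nth ((K oo ?mX) * fps_cpow (power_sum m ?y) (of_nat k)) n = of_nat m ^ n * sum F ?V" .
  have "fps_has_cpow (genocchi_base lam) (of_nat k)"
    by (simp add: fps_has_cpow_def)
  from apostol_genocchi_eq[OF m this, of n x, folded K_def]
  show "apostol_genocchi n (of_nat k) (of_nat m * x) lam = (- 2) powr (of_nat k) * of_nat m powr (of_nat n - of_nat k) * sum F ?V"
    by (simp only: prefactor_eq[OF m(2)] mult.assoc eq)
qed

text \<open>A non-natural \<alpha> forces lam = -1, so (-lam)^r and, m being even, lam^m are both 1.
  Abel's theorem converts the assumed limit into boundary values of t d/dt applied repeatedly to A,
  which are known.\<close>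

lemma apostol_genocchi_eq_lim:
  fixes m n :: nat and \<alpha> x :: complex
  assumes m: "even m" "m > 0"
  defines "F \<equiv> (\<lambda>v. multinom m \<alpha> v * apostol_bernoulli n \<alpha> (x + of_nat (weight m v) / of_nat m) 1)"
  assumes L: "(\<lambda>N. \<Sum>v \<in> {v \<in> tuples m. weight m v \<le> N}. F v) \<longlonglongrightarrow> L"
  shows "apostol_genocchi n \<alpha> (of_nat m * x) (- 1) = (- 2) powr \<alpha> * of_nat m powr (of_nat n - \<alpha>) * L"
proof -
  let ?mX = "fps_const (of_nat m) * fps_X :: complex fps"
  define K where "K = fps_cpow (bernoulli_base 1) \<alpha> * fps_exp x"
  define A where "A = fps_binomial \<alpha> oo (\<Sum>i = 1..m - 1. fps_X ^ i)"
  define T where "T = fps_cpow (power_sum m (fps_exp 1)) \<alpha>"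
  \<comment> \<open>The coefficients of Q: as a function of r, the Bernoulli polynomial at x + r/m
    has degree at most n. Then \<open>b r\<close> is the total of all terms of weight r.\<close>
  define q where "q k = fact n * fps_nth K (n - k) / of_nat m ^ k / fact k" for k
  define b where "b r = (\<Sum>k\<le>n. q k * (of_nat r ^ k * fps_nth A r))" for r
  have T: "T = fps_cpow (\<Sum>i<m. fps_exp 1 ^ i) \<alpha>"
    using m by (simp add: T_def power_sum_eq)
  note A1 = tendsto_eval_euler_deriv_power_sum(1)[OF m(2), of \<alpha>, folded A_def]
  note lim = tendsto_eval_euler_deriv_power_sum(2)[OF m(2), of _ \<alpha>, folded A_def T]

  have bern: "apostol_bernoulli n \<alpha> (x + of_nat r / of_nat m) 1 = (\<Sum>k\<le>n. q k * of_nat r ^ k)" for r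
  proof -
    have "fps_nth (K * fps_exp (of_nat r / of_nat m)) n = (\<Sum>k\<le>n. (of_nat r / of_nat m) ^ k / fact k * fps_nth K (n - k))"
      by (subst mult.commute) (simp add: fps_mult_nth atLeast0AtMost)
    then show ?thesis
      unfolding apostol_bernoulli_add K_def[symmetric]
      by (simp add: q_def sum_distrib_left power_divide mult_ac)
  qed
  have "(\<Sum>v \<in> {v \<in> tuples m. weight m v \<le> N}. F v) = (\<Sum>r\<le>N. b r)" for N
  proof -
    have "(\<Sum>v \<in> {v \<in> tuples m. weight m v \<le> N}. F v) =
        (\<Sum>r\<le>N. \<Sum>v | v \<in> {v \<in> tuples m. weight m v \<le> N} \<and> weight m v = r. F v)"
      by (rule sum.group[symmetric, OF finite_tuples_weight_le]) auto
    also have "\<dots> = (\<Sum>r\<le>N. b r)"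
    proof (rule sum.cong[OF refl])
      fix r assume "r \<in> {..N}"
      then have "(\<Sum>v | v \<in> {v \<in> tuples m. weight m v \<le> N} \<and> weight m v = r. F v) =
          (\<Sum>v | v \<in> tuples m \<and> weight m v = r. multinom m \<alpha> v * (\<Sum>k\<le>n. q k * of_nat r ^ k))"
        by (intro sum.cong) (auto simp: F_def bern)
      also have "\<dots> = fps_nth A r * (\<Sum>k\<le>n. q k * of_nat r ^ k)"
        by (simp only: A_def fps_nth_binomial_compose_power_sum sum_distrib_right)
      finally show "(\<Sum>v | v \<in> {v \<in> tuples m. weight m v \<le> N} \<and> weight m v = r. F v) = b r"
        by (simp add: b_def sum_distrib_left mult_ac)
    qed
    finally show ?thesis .
  qed
  with L have "b sums L"
    by (simp add: sums_def_le)
  then have "((\<lambda>t. \<Sum>r. b r * of_real t ^ r) \<longlongrightarrow> L) (at_left (1::real))"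
    by (rule Abel_limit)
  \<comment> \<open>For 0 < t < 1 every series in r converges, so the finite sum over k may be taken
    outside.\<close>
  moreover have "eventually (\<lambda>t. (\<Sum>r. b r * of_real t ^ r) = (\<Sum>k\<le>n. q k * eval_fps ((euler_deriv ^^ k) A) (of_real t))) (at_left (1::real))"
  proof (rule eventually_at_leftI[of 0])
    fix t :: real assume t: "t \<in> {0<..<1}"
    have "(\<lambda>r. of_nat r ^ k * fps_nth A r * of_real t ^ r) sums eval_fps ((euler_deriv ^^ k) A) (of_real t)" for k
    proof -
      have "ereal (norm (of_real t :: complex)) < 1"
        using t by simp
      also have "1 \<le> fps_conv_radius ((euler_deriv ^^ k) A)"
        using A1 fps_conv_radius_euler_deriv_iter order_trans by blast
      finally show ?thesis
        by (rule sums_eval_fps[of _ "(euler_deriv ^^ k) A", unfolded fps_nth_euler_deriv_iter])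
    qed
    then have "(\<lambda>r. \<Sum>k\<le>n. q k * (of_nat r ^ k * fps_nth A r * of_real t ^ r)) sums (\<Sum>k\<le>n. q k * eval_fps ((euler_deriv ^^ k) A) (of_real t))"
      by (intro sums_sum sums_mult)
    moreover have "b r * of_real t ^ r = (\<Sum>k\<le>n. q k * (of_nat r ^ k * fps_nth A r * of_real t ^ r))" for r
      by (simp only: b_def sum_distrib_right mult.assoc)
    ultimately show "(\<Sum>r. b r * of_real t ^ r) = (\<Sum>k\<le>n. q k * eval_fps ((euler_deriv ^^ k) A) (of_real t))"
      by (simp add: sums_iff)
  qed simp
  ultimately have "((\<lambda>t. \<Sum>k\<le>n. q k * eval_fps ((euler_deriv ^^ k) A) (of_real t)) \<longlongrightarrow> L) (at_left (1::real))"
    using tendsto_cong by force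
  moreover have "((\<lambda>t. \<Sum>k\<le>n. q k * eval_fps ((euler_deriv ^^ k) A) (of_real t)) \<longlongrightarrow> (\<Sum>k\<le>n. q k * (fact k * fps_nth T k))) (at_left (1::real))"
    by (intro tendsto_intros lim)
  ultimately have L_eq: "L = (\<Sum>k\<le>n. q k * (fact k * fps_nth T k))"
    using tendsto_unique trivial_limit_at_left_real by blast
  \<comment> \<open>The Cauchy product for coefficient n of K(mz) T(z) yields the same sum over k,
    since m^(n-k) = m^n / m^k.\<close>
  have "fact n * fps_nth ((K oo ?mX) * T) n = (\<Sum>k\<le>n. fact n * (fps_nth T k * (of_nat m ^ (n - k) * fps_nth K (n - k))))"
    by (subst mult.commute[of _ T]) (simp add: fps_mult_nth fps_compose_linear atLeast0AtMost sum_distrib_left)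
  also have "\<dots> = of_nat m ^ n * L"
    unfolding L_eq sum_distrib_left
  proof (rule sum.cong[OF refl])
    fix k assume "k \<in> {..n}"
    then have "(of_nat m :: complex) ^ n = of_nat m ^ k * of_nat m ^ (n - k)"
      by (simp flip: power_add)
    then show "fact n * (fps_nth T k * (of_nat m ^ (n - k) * fps_nth K (n - k))) = of_nat m ^ n * (q k * (fact k * fps_nth T k))"
      using m by (simp add: q_def)
  qed
  finally have eq: "fact n * fps_nth ((K oo ?mX) * T) n = of_nat m ^ n * L" .
  have "fps_has_cpow (genocchi_base (- 1)) \<alpha>"
    by (simp add: fps_has_cpow_genocchi_base_iff)
  from apostol_genocchi_eq[OF m this, of n x] m(1)
  have "apostol_genocchi n \<alpha> (of_nat m * x) (- 1) = (- 2) powr \<alpha> * of_nat m powr (- \<alpha>) * fact n * fps_nth ((K oo ?mX) * T) n"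
    by (simp add: K_def T_def)
  then show ?thesis
    by (simp only: prefactor_eq[OF m(2)] mult.assoc eq)
qed

theorem theorem2p4:
  fixes m n :: nat and \<alpha> lam x :: complex
  assumes "even m" and "m > 0"
    and "fps_has_cpow (genocchi_base lam) \<alpha>"
  shows
    "let c = (- 2) powr \<alpha> * of_nat m powr (of_nat n - \<alpha>);
         F = (\<lambda>v. multinom m \<alpha> v * (- lam) ^ weight m v *
                  apostol_bernoulli n \<alpha> (x + of_nat (weight m v) / of_nat m) (lam ^ m));
         G = apostol_genocchi n \<alpha> (of_nat m * x) lam;
         P = (\<lambda>N. \<Sum>v \<in> {v \<in> tuples m. weight m v \<le> N}. F v)
     in (\<alpha> \<in> \<nat> \<or> F summable_on tuples m \<longrightarrow>
           F summable_on tuples m \<and> G = c * (\<Sum>\<^sub>\<infinity>v \<in> tuples m. F v)) \<and>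
        (convergent P \<longrightarrow> G = c * lim P)"
proof -
  define c where "c = (- 2) powr \<alpha> * of_nat m powr (of_nat n - \<alpha>)"
  define F where "F v = multinom m \<alpha> v * (- lam) ^ weight m v *
      apostol_bernoulli n \<alpha> (x + of_nat (weight m v) / of_nat m) (lam ^ m)" for v
  define G where "G = apostol_genocchi n \<alpha> (of_nat m * x) lam"
  define P where "P N = (\<Sum>v \<in> {v \<in> tuples m. weight m v \<le> N}. F v)" for N
  have P: "P \<longlonglongrightarrow> s" if "(F has_sum s) (tuples m)" for s
    using has_sum_imp_tendsto_weight[OF that] by (simp add: P_def[abs_def])
  have "(\<alpha> \<in> \<nat> \<or> F summable_on tuples m \<longrightarrow>
           F summable_on tuples m \<and> G = c * (\<Sum>\<^sub>\<infinity>v \<in> tuples m. F v)) \<and>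
        (convergent P \<longrightarrow> G = c * lim P)"
  proof (cases "\<alpha> \<in> \<nat>")
    case True
    then obtain k where k: "\<alpha> = of_nat k" by (auto elim: Nats_cases)
    obtain s where s: "(F has_sum s) (tuples m)" "G = c * s"
      by (rule has_sum_apostol_genocchi_nat[OF assms(1,2), of k lam n x, folded k, folded F_def[abs_def] G_def c_def])
    moreover have "lim P = s"
      using P[OF s(1)] by (rule limI)
    ultimately show ?thesis
      by (auto simp: infsumI has_sum_imp_summable)
  next
    case False
    then have lam: "lam = - 1"
      using assms(3) by (simp add: fps_has_cpow_genocchi_base_iff)
    have G: "G = c * L" if "P \<longlonglongrightarrow> L" for L
      using apostol_genocchi_eq_lim[OF assms(1,2), of \<alpha> n x L] that assms(1)
      by (simp add: lam F_def P_def[abs_def] G_def c_def)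
    show ?thesis
      \<comment> \<open>Unconditional summability makes \<open>P\<close> converge to the infinite
        sum, so both claims follow from the statement about limits of \<open>P\<close>.\<close>
      using False P[OF has_sum_infsum] by (auto intro!: G simp: convergent_LIMSEQ_iff)
  qed
  then show ?thesis
    unfolding Let_def c_def F_def[abs_def] G_def P_def[abs_def] .
qed

end
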